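(* Let $X$ be an infinite-dimensional Banach space (real or complex). Suppose that either (i) $X$ contains a normalised basic sequence satisfying a lower $q$-estimate for some $q<\infty$, or (ii) $X$ has finite cotype $q$. Then for every $\varepsilon>0$ the unit sphere of $X$ contains a symmetrically $(2^{1/q}-\varepsilon)$-separated sequence.
   Context: A normalised basic sequence $(x_n)_{n=1}^\infty$ satisfies a lower $q$-estimate if there is a constant $c>0$ such that $c\left(\sum_{n=1}^N|a_n|^q\right)^{1/q}\le\left\|\sum_{n=1}^N a_nx_n\right\|$ for every $N\in\mathbb N$ and every choice of scalars $a_1,\dots,a_N$. Cotype $q$ (with $q\in[2,\infty)$ for finite cotype) is understood in the usual sense. A sequence $(x_n)$ is symmetrically $\delta$-separated if $\|x_n\pm x_k\|\ge\delta$ (both signs) for all $n\neq k$. *)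

theory Defs
  imports "HOL-Analysis.Analysis"
begin

text \<open>
  Real and complex scalars are treated uniformly. Up to an isometric isomorphism of fields, the
  only types in the following class are \<^typ>\<open>real\<close> and \<^typ>\<open>complex\<close>.
\<close>

class real_or_complex = real_normed_field +
  assumes real_or_complex:
    "(\<forall>z. \<exists>a. z = a *\<^sub>R 1) \<or>
     (\<exists>i. i * i = - 1 \<and>
       (\<forall>z. \<exists>a b. z = a *\<^sub>R 1 + b *\<^sub>R i \<and> norm z = sqrt (a\<^sup>2 + b\<^sup>2)))"

instance real :: real_or_complex
  by standard (simp add: real_scaleR_def)

instance complex :: real_or_complex
proof
  have "\<exists>a b. z = a *\<^sub>R 1 + b *\<^sub>R \<i> \<and> norm z = sqrt (a\<^sup>2 + b\<^sup>2)" for z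
    by (rule exI[of _ "Re z"], rule exI[of _ "Im z"]) (simp add: complex_eq_iff cmod_def)
  then show "(\<forall>z::complex. \<exists>a. z = a *\<^sub>R 1) \<or>
     (\<exists>i::complex. i * i = - 1 \<and>
       (\<forall>z. \<exists>a b. z = a *\<^sub>R 1 + b *\<^sub>R i \<and> norm z = sqrt (a\<^sup>2 + b\<^sup>2)))"
    by (intro disjI2 exI[of _ \<i>]) simp
qed

text \<open>
  A Banach space over \<open>'k\<close> is a type of class \<^class>\<open>banach\<close> (which records the norm, completeness
  and the underlying real structure) with a multiplication by scalars from \<open>'k\<close> that extends the
  real one and is compatible with the norm.
\<close>

locale banach_over = vector_space smul
  for smul :: "'k::real_or_complex \<Rightarrow> 'a::banach \<Rightarrow> 'a" +
  assumes smul_of_real: "smul (of_real r) x = r *\<^sub>R x"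
    and norm_smul: "norm (smul c x) = norm c * norm x"

lemma banach_over_scaleR: "banach_over (scaleR :: real \<Rightarrow> 'a::banach \<Rightarrow> 'a)"
  by standard (auto simp: algebra_simps)

lemma banach_over_complex: "banach_over ((*) :: complex \<Rightarrow> complex \<Rightarrow> complex)"
  by standard (auto simp: algebra_simps norm_mult scaleR_conv_of_real)

definition infinite_dimensional :: "('k::field \<Rightarrow> 'a::ab_group_add \<Rightarrow> 'a) \<Rightarrow> bool" where
  "infinite_dimensional smul \<longleftrightarrow> \<not> (\<exists>B. finite B \<and> module.span smul B = UNIV)"

text \<open>A basic sequence is a Schauder basis of its closed linear span.\<close>

definition basic_sequence ::
    "('k::real_or_complex \<Rightarrow> 'a::banach \<Rightarrow> 'a) \<Rightarrow> (nat \<Rightarrow> 'a) \<Rightarrow> bool" where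
  "basic_sequence smul x \<longleftrightarrow>
     (\<forall>v \<in> closure (module.span smul (range x)). \<exists>!a. (\<lambda>n. smul (a n) (x n)) sums v)"

definition normalised :: "(nat \<Rightarrow> 'a::real_normed_vector) \<Rightarrow> bool" where
  "normalised x \<longleftrightarrow> (\<forall>n. norm (x n) = 1)"

definition lower_estimate ::
    "('k::real_or_complex \<Rightarrow> 'a::banach \<Rightarrow> 'a) \<Rightarrow> real \<Rightarrow> (nat \<Rightarrow> 'a) \<Rightarrow> bool" where
  "lower_estimate smul q x \<longleftrightarrow>
     (\<exists>c>0. \<forall>N. \<forall>a :: nat \<Rightarrow> 'k.
        c * (\<Sum>n<N. norm (a n) powr q) powr (1 / q) \<le> norm (\<Sum>n<N. smul (a n) (x n)))"

text \<open>
  The mean square of the norm of the Rademacher sum of \<open>x 0, \<dots>, x (N - 1)\<close>, i.e. the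
  expectation over independent, uniformly distributed signs.
\<close>

definition rademacher_mean_square :: "nat \<Rightarrow> (nat \<Rightarrow> 'a::real_normed_vector) \<Rightarrow> real" where
  "rademacher_mean_square N x =
     (\<Sum>s \<in> {..<N} \<rightarrow>\<^sub>E {-1, 1 :: real}. (norm (\<Sum>n<N. s n *\<^sub>R x n))\<^sup>2) / 2 ^ N"

definition has_cotype :: "'a::real_normed_vector itself \<Rightarrow> real \<Rightarrow> bool" where
  "has_cotype _ q \<longleftrightarrow>
     (\<exists>C>0. \<forall>N. \<forall>x :: nat \<Rightarrow> 'a.
        (\<Sum>n<N. norm (x n) powr q) powr (1 / q) \<le> C * sqrt (rademacher_mean_square N x))"

definition symmetrically_separated :: "real \<Rightarrow> (nat \<Rightarrow> 'a::real_normed_vector) \<Rightarrow> bool" where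
  "symmetrically_separated \<delta> x \<longleftrightarrow>
     (\<forall>n k. n \<noteq> k \<longrightarrow> norm (x n + x k) \<ge> \<delta> \<and> norm (x n - x k) \<ge> \<delta>)"

end

theory Submission
  imports Defs "HOL-Library.Ramsey"
begin

text \<open>
  (i) As in James's distortion argument, let \<open>\<kappa>\<close> be an almost optimal constant in the lower estimate
  for vectors supported on a tail of \<open>x\<close>. Norm-one block vectors far out can be chosen with
  \<open>\<ell>\<^sub>q\<close>-norm of their coefficients at least \<open>t / \<kappa>\<close>, where \<open>t < 1\<close> is close to \<open>1\<close>. The \<open>q\<close>-th
  powers of these norms add up for disjoint supports, so sums and differences have norm at least
  \<open>2 powr (1 / q) * t\<close>.

  (ii) If no sequence is symmetrically \<open>\<delta>\<close>-separated, then by Ramsey's theorem every bounded sequence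
  has a subsequence with \<open>norm (u n + \<sigma> *\<^sub>R u k) \<le> \<delta>' * r\<close> for a fixed sign \<open>\<sigma>\<close>, where \<open>r\<close> bounds
  the norms and \<open>\<delta> < \<delta>' < 2 powr (1 / q)\<close>. Iterating this on sums of pairs yields signed sums of
  \<open>2 ^ m\<close> terms of norm at most \<open>\<delta>' ^ m * r\<close>. Applied to differences of a separated sequence, which
  after another use of Ramsey's theorem are unconditional up to an additive constant on sets of
  \<open>2 ^ m\<close> indices, this bounds all signed sums of these terms, contradicting cotype \<open>q\<close> for large \<open>m\<close>.
\<close>

subsection \<open>Ramsey arguments\<close>

text \<open>Colour an \<open>r\<close>-element set by the value of \<open>f\<close> at its
  increasing enumeration. Ramsey's theorem gives an infinite homogeneous set, which \<open>g\<close>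
  enumerates; by \<open>cong\<close> only the first \<open>r\<close> entries of a tuple matter. The
  bijection \<open>h\<close> merely codes colours as numbers.\<close>

lemma Ramsey_increasing:
  fixes f :: "(nat \<Rightarrow> nat) \<Rightarrow> 'c"
  assumes "finite C" and C: "\<And>p. f p \<in> C"
    and cong: "\<And>p p'. (\<And>i. i < r \<Longrightarrow> p i = p' i) \<Longrightarrow> f p = f p'"
  shows "\<exists>(g :: nat \<Rightarrow> nat) c. strict_mono g \<and> (\<forall>p. strict_mono_on {..<r} p \<longrightarrow> f (g \<circ> p) = c)"
proof -
  obtain h where h: "bij_betw h C {0..<card C}"
    using ex_bij_betw_finite_nat[OF \<open>finite C\<close>] by blast
  define col where "col X = h (f (\<lambda>i. sorted_list_of_set X ! i))" for X :: "nat set"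
  have "col X < card C" for X
    using bij_betwE[OF h] C unfolding col_def by fastforce
  then obtain Y t where Y: "infinite Y"
      and t: "\<And>X. X \<subseteq> Y \<Longrightarrow> finite X \<Longrightarrow> card X = r \<Longrightarrow> col X = t"
    using Ramsey[of "UNIV :: nat set" r col "card C"] by auto
  define g where "g = enumerate Y"
  have g: "strict_mono g"
    unfolding g_def using Y by (rule strict_mono_enumerate)
  have "h (f (g \<circ> p)) = t" if p: "strict_mono_on {..<r} p" for p
  proof -
    let ?s = "g \<circ> p"
    have s: "strict_mono_on {..<r} ?s"
      using g p by (auto simp: strict_mono_on_def strict_mono_def)
    have inj: "inj_on ?s {..<r}"
      using s by (rule strict_mono_on_imp_inj_on)
    \<comment> \<open>An increasing tuple is the sorted list of its own image, so the colour of that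
      image is the code of \<open>f ?s\<close>.\<close>
    have "sorted_list_of_set (?s ` {..<r}) = map ?s [0..<r]"
    proof (rule sorted_distinct_set_unique)
      show "sorted (map ?s [0..<r])"
        using s by (auto simp: sorted_iff_nth_mono_less strict_mono_on_def less_imp_le)
      show "distinct (map ?s [0..<r])"
        using inj by (simp add: distinct_map atLeast0LessThan)
    qed (auto simp: atLeast0LessThan)
    then have "f (\<lambda>i. sorted_list_of_set (?s ` {..<r}) ! i) = f ?s"
      by (intro cong) simp
    moreover have "?s ` {..<r} \<subseteq> Y"
      using Y by (auto simp: g_def enumerate_in_set)
    moreover have "card (?s ` {..<r}) = r"
      using card_image[OF inj] by simp
    ultimately show ?thesis
      using t[of "?s ` {..<r}"] by (simp add: col_def)
  qed
  moreover have "inj_on h C"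
    using h by (rule bij_betw_imp_inj_on)
  ultimately have "f (g \<circ> p) = inv_into C h t" if "strict_mono_on {..<r} p" for p
    using that C by (metis inv_into_f_f)
  with g show ?thesis by blast
qed

section \<open>Approximate suppression unconditionality of differences\<close>

text \<open>Ramsey's theorem for the \<open>2 * M\<close> indices involved makes the norm of a
  signed sum of \<open>M\<close> differences almost independent of where the pairs of indices sit.
  Terms outside \<open>A\<close> can then be averaged over shifted pairs, where they telescope and
  nearly vanish. Differences of a spreading sequence are suppression unconditional for the same
  reason.\<close>

lemma almost_unconditional_differences:
  fixes x :: "nat \<Rightarrow> 'a::real_normed_vector"
  assumes x: "\<And>n. norm (x n) \<le> 1" and "0 < M"
  shows "\<exists>z :: nat \<Rightarrow> 'a. (\<forall>n. \<exists>i j. i \<noteq> j \<and> z n = x i - x j) \<and>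
    (\<forall>F A \<theta>. finite F \<and> card F = M \<and> A \<subseteq> F \<and> \<theta> ` F \<subseteq> {-1, 1} \<longrightarrow>
       norm (\<Sum>n\<in>A. \<theta> n *\<^sub>R z n) \<le> norm (\<Sum>n\<in>F. \<theta> n *\<^sub>R z n) + 1 / 2)"
proof -
  define D where "D p c = norm (\<Sum>i<M. c i *\<^sub>R (x (p (2 * i)) - x (p (2 * i + 1))))"
    for p :: "nat \<Rightarrow> nat" and c :: "nat \<Rightarrow> real"
  let ?S = "{..<M} \<rightarrow>\<^sub>E {-1, 1 :: real}"
  \<comment> \<open>For each sign vector the colour records the norm rounded down to a multiple of
    1/4. Norms are at most \<open>2 * M\<close>, so there are finitely many colours, and equal
    colours mean norms within 1/4.\<close>
  define f where "f p = (\<lambda>c\<in>?S. \<lfloor>4 * D p c\<rfloor>)" for p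
  have diff: "norm (x i - x j) \<le> 2" for i j
    using norm_triangle_ineq4[of "x i" "x j"] x[of i] x[of j] by linarith
  have D_le: "D p c \<le> 2 * M" if "c \<in> ?S" for p c
  proof -
    have "D p c \<le> (\<Sum>i<M. norm (c i *\<^sub>R (x (p (2 * i)) - x (p (2 * i + 1)))))"
      unfolding D_def by (rule norm_sum)
    also have "\<dots> \<le> (\<Sum>i<M. 2)"
    proof (rule sum_mono)
      fix i assume "i \<in> {..<M}"
      with that have "c i \<in> {-1, 1}" by blast
      then show "norm (c i *\<^sub>R (x (p (2 * i)) - x (p (2 * i + 1)))) \<le> 2"
        using diff by auto
    qed
    finally show ?thesis by simp
  qed
  have f_in: "f p \<in> ?S \<rightarrow>\<^sub>E {0..8 * int M}" for p
  proof -
    have "\<lfloor>4 * D p c\<rfloor> \<in> {0..8 * int M}" if "c \<in> ?S" for c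
    proof -
      have "0 \<le> D p c" by (simp add: D_def)
      moreover have "4 * D p c \<le> of_int (8 * int M)"
        using D_le[OF that, of p] by simp
      ultimately show ?thesis
        by (simp add: floor_le_iff)
    qed
    then show ?thesis by (simp add: f_def)
  qed
  have f_cong: "f p = f p'" if "\<And>i. i < 2 * M \<Longrightarrow> p i = p' i" for p p'
  proof -
    have "D p = D p'"
      unfolding D_def using that by (intro ext arg_cong[of _ _ norm] sum.cong) auto
    then show ?thesis by (simp add: f_def)
  qed
  have fin: "finite (?S \<rightarrow>\<^sub>E {0..8 * int M})"
    by (intro finite_PiE) auto
  have "\<exists>(g :: nat \<Rightarrow> nat) col. strict_mono g \<and>
      (\<forall>p. strict_mono_on {..<2 * M} p \<longrightarrow> f (g \<circ> p) = col)"
    using fin f_in f_cong by (rule Ramsey_increasing)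
  then obtain g :: "nat \<Rightarrow> nat" and col where g: "strict_mono g"
    and col: "\<And>p. strict_mono_on {..<2 * M} p \<Longrightarrow> f (g \<circ> p) = col"
    by blast
  have D_close: "D (g \<circ> p) c \<le> D (g \<circ> p') c + 1 / 4"
    if "strict_mono_on {..<2 * M} p" "strict_mono_on {..<2 * M} p'" "c \<in> ?S" for p p' c
  proof -
    have "f (g \<circ> p) c = f (g \<circ> p') c"
      using col that by simp
    then have "\<lfloor>4 * D (g \<circ> p) c\<rfloor> = \<lfloor>4 * D (g \<circ> p') c\<rfloor>"
      using that by (simp add: f_def)
    then show ?thesis by linarith
  qed
  \<comment> \<open>The telescoped remainder is at most \<open>2 * M\<close>, so dividing by
    \<open>k\<close> leaves 1/4; together with the 1/4 from the colouring this gives the final 1/2.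
    Blocks of length \<open>L\<close> contain both \<open>t\<close> and \<open>t + 1\<close> for all
    \<open>t < k\<close>, so pairs from different blocks never interlace.\<close>
  define k where "k = 8 * M"
  define L where "L = k + 2"
  define w where "w n t = x (g (L * n + t)) - x (g (L * n + t + 1))" for n t
  have shift: "norm (\<Sum>n\<in>F. \<theta> n *\<^sub>R w n (if n \<in> A then 0 else t))
      \<le> norm (\<Sum>n\<in>F. \<theta> n *\<^sub>R w n 0) + 1 / 4"
    if F: "finite F" "card F = M" and \<theta>: "\<theta> ` F \<subseteq> {-1, 1}" and t: "t < k" for F A \<theta> t
  proof -
    define q where "q i = sorted_list_of_set F ! i" for i
    have q_mono: "q i < q j" if "i < j" "j < M" for i j
      using that F by (simp add: q_def sorted_wrt_nth_less strict_sorted_list_of_set)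
    have q_bij: "bij_betw q {..<M} F"
      unfolding q_def using F by (intro bij_betw_nth) auto
    \<comment> \<open>Entries \<open>2 * i\<close> and \<open>2 * i + 1\<close> are the two ends of
      the pair in block \<open>q i\<close>; it sits at the start of its block if \<open>q i\<close>
      lies in \<open>A\<close> and is moved by \<open>s\<close> otherwise.\<close>
    define p where "p s j = L * q (j div 2) + j mod 2 + (if q (j div 2) \<in> A then 0 else s)" for s j
    define c where "c = (\<lambda>i\<in>{..<M}. \<theta> (q i))"
    have c: "c \<in> ?S"
      using \<theta> bij_betwE[OF q_bij] by (auto simp: c_def)
    have p: "strict_mono_on {..<2 * M} (p s)" if s: "s < k" for s
    proof (rule strict_mono_onI)
      fix i j :: nat
      assume ij: "i \<in> {..<2 * M}" "j \<in> {..<2 * M}" "i < j"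
      show "p s i < p s j"
      proof (cases "i div 2 = j div 2")
        case True
        with ij have "i mod 2 < j mod 2"
          by (metis div_mult_mod_eq nat_add_left_cancel_less)
        with True show ?thesis by (simp add: p_def)
      next
        case False
        with ij have "i div 2 < j div 2"
          by (meson div_le_mono le_neq_implies_less less_imp_le)
        then have "Suc (q (i div 2)) \<le> q (j div 2)"
          using q_mono ij by (simp add: Suc_le_eq less_mult_imp_div_less mult.commute)
        then have "L * q (i div 2) + L \<le> L * q (j div 2)"
          by (metis mult_Suc_right mult_le_mono2 add.commute)
        moreover have "i mod 2 + s < L"
          using s by (simp add: L_def)
        ultimately show ?thesis by (auto simp: p_def)
      qed
    qed
    have D_eq: "D (g \<circ> p s) c = norm (\<Sum>n\<in>F. \<theta> n *\<^sub>R w n (if n \<in> A then 0 else s))" for s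
    proof -
      have "(\<Sum>n\<in>F. \<theta> n *\<^sub>R w n (if n \<in> A then 0 else s))
          = (\<Sum>i<M. \<theta> (q i) *\<^sub>R w (q i) (if q i \<in> A then 0 else s))"
        using q_bij by (rule sum.reindex_bij_betw[symmetric])
      also have "\<dots> = (\<Sum>i<M. c i *\<^sub>R (x ((g \<circ> p s) (2 * i)) - x ((g \<circ> p s) (2 * i + 1))))"
      proof (rule sum.cong)
        fix i assume "i \<in> {..<M}"
        moreover have "(2 * i + 1) mod 2 = 1" "(2 * i + 1) div 2 = i"
          by presburger+
        ultimately show "\<theta> (q i) *\<^sub>R w (q i) (if q i \<in> A then 0 else s)
            = c i *\<^sub>R (x ((g \<circ> p s) (2 * i)) - x ((g \<circ> p s) (2 * i + 1)))"
          by (simp add: c_def w_def p_def)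
      qed simp
      finally show ?thesis by (simp add: D_def)
    qed
    have "0 < k" using \<open>0 < M\<close> by (simp add: k_def)
    then show ?thesis
      using D_close[OF p[OF t] p[of 0] c] by (simp add: D_eq)
  qed
  have suppress: "norm (\<Sum>n\<in>A. \<theta> n *\<^sub>R w n 0) \<le> norm (\<Sum>n\<in>F. \<theta> n *\<^sub>R w n 0) + 1 / 2"
    if F: "finite F" "card F = M" and A: "A \<subseteq> F" and \<theta>: "\<theta> ` F \<subseteq> {-1, 1}" for F A \<theta>
  proof -
    let ?V = "\<lambda>t. \<Sum>n\<in>F. \<theta> n *\<^sub>R w n (if n \<in> A then 0 else t)"
    let ?a = "\<Sum>n\<in>A. \<theta> n *\<^sub>R w n 0"
    let ?R = "\<Sum>n\<in>F - A. \<theta> n *\<^sub>R (x (g (L * n)) - x (g (L * n + k)))"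
    \<comment> \<open>Averaging over \<open>t\<close> makes the terms outside \<open>A\<close> telescope.\<close>
    have "?V t = ?a + (\<Sum>n\<in>F - A. \<theta> n *\<^sub>R w n t)" for t
    proof -
      have "?V t = (\<Sum>n\<in>A. \<theta> n *\<^sub>R w n (if n \<in> A then 0 else t))
          + (\<Sum>n\<in>F - A. \<theta> n *\<^sub>R w n (if n \<in> A then 0 else t))"
        unfolding sum.subset_diff[OF A F(1)] by (rule add.commute)
      also have "(\<Sum>n\<in>A. \<theta> n *\<^sub>R w n (if n \<in> A then 0 else t)) = ?a"
        by (rule sum.cong) auto
      also have "(\<Sum>n\<in>F - A. \<theta> n *\<^sub>R w n (if n \<in> A then 0 else t)) = (\<Sum>n\<in>F - A. \<theta> n *\<^sub>R w n t)"
        by (rule sum.cong) auto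
      finally show ?thesis .
    qed
    then have "(\<Sum>t<k. ?V t) = real k *\<^sub>R ?a + (\<Sum>t<k. \<Sum>n\<in>F - A. \<theta> n *\<^sub>R w n t)"
      by (simp add: sum.distrib sum_constant_scaleR)
    also have "(\<Sum>t<k. \<Sum>n\<in>F - A. \<theta> n *\<^sub>R w n t) = (\<Sum>n\<in>F - A. \<theta> n *\<^sub>R (\<Sum>t<k. w n t))"
      by (subst sum.swap) (simp add: scaleR_right.sum)
    also have "\<dots> = ?R"
      using sum_lessThan_telescope'[of "\<lambda>t. x (g (L * n + t))" k for n] by (simp add: w_def)
    finally have "real k *\<^sub>R ?a = (\<Sum>t<k. ?V t) - ?R" by simp
    then have "real k * norm ?a = norm ((\<Sum>t<k. ?V t) - ?R)"
      by (metis norm_scaleR abs_of_nat)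
    also have "\<dots> \<le> norm (\<Sum>t<k. ?V t) + norm ?R"
      by (rule norm_triangle_ineq4)
    also have "norm (\<Sum>t<k. ?V t) \<le> (\<Sum>t<k. norm (\<Sum>n\<in>F. \<theta> n *\<^sub>R w n 0) + 1 / 4)"
      using shift[OF F \<theta>] by (intro sum_norm_le) auto
    also have "norm ?R \<le> (\<Sum>n\<in>F - A. 2)"
    proof (rule sum_norm_le)
      fix n assume "n \<in> F - A"
      with \<theta> have "\<theta> n \<in> {-1, 1}" by blast
      then show "norm (\<theta> n *\<^sub>R (x (g (L * n)) - x (g (L * n + k)))) \<le> 2"
        using diff by auto
    qed
    also have "\<dots> \<le> 2 * real M"
      using F card_mono[of F "F - A"] by simp
    finally have "real k * norm ?a \<le> real k * (norm (\<Sum>n\<in>F. \<theta> n *\<^sub>R w n 0) + 1 / 2)"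
      by (simp add: k_def algebra_simps)
    then show ?thesis
      using \<open>0 < M\<close> by (simp add: k_def)
  qed
  have w_diff: "\<exists>i j. i \<noteq> j \<and> w n 0 = x i - x j" for n
  proof (intro exI conjI)
    show "g (L * n) \<noteq> g (L * n + 1)"
      using strict_mono_eq[OF g] by simp
    show "w n 0 = x (g (L * n)) - x (g (L * n + 1))"
      by (simp add: w_def)
  qed
  show ?thesis
  proof (rule exI[of _ "\<lambda>n. w n 0"], intro conjI allI impI w_diff)
    fix F A :: "nat set" and \<theta> :: "nat \<Rightarrow> real"
    assume "finite F \<and> card F = M \<and> A \<subseteq> F \<and> \<theta> ` F \<subseteq> {-1, 1}"
    then show "norm (\<Sum>n\<in>A. \<theta> n *\<^sub>R w n 0) \<le> norm (\<Sum>n\<in>F. \<theta> n *\<^sub>R w n 0) + 1 / 2"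
      by (intro suppress) auto
  qed
qed

section \<open>Small signed sums when the sphere has no separated sequence\<close>

text \<open>Pass to a subsequence whose norms converge to some \<open>s\<close>. If
  \<open>s = 0\<close>, far terms are small enough for either sign. Otherwise normalise and colour
  pairs by a sign that violates separation; homogeneity with no such sign would produce a separated
  sequence. Undoing the normalisation costs an error absorbed by the gap between
  \<open>\<delta>\<close> and \<open>\<delta>'\<close>.\<close>

lemma unseparated_subsequence:
  fixes u :: "nat \<Rightarrow> 'a::real_normed_vector"
  assumes nsep: "\<not> (\<exists>y :: nat \<Rightarrow> 'a. (\<forall>n. y n \<in> sphere 0 1) \<and> symmetrically_separated \<delta> y)"
    and "0 \<le> \<delta>" "\<delta> < \<delta>'" "0 < r" and u: "\<And>n. norm (u n) \<le> r"
  shows "\<exists>(g :: nat \<Rightarrow> nat) \<sigma>. strict_mono g \<and> \<sigma> \<in> {-1, 1} \<and>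
    (\<forall>n k. n < k \<longrightarrow> norm (u (g n) + \<sigma> *\<^sub>R u (g k)) \<le> \<delta>' * r)"
proof -
  have "bounded (range (\<lambda>n. norm (u n)))"
    using u by (auto simp: bounded_iff)
  then obtain s g0 where g0: "strict_mono g0" and lim: "(\<lambda>n. norm (u (g0 n))) \<longlonglongrightarrow> s"
    using bounded_imp_convergent_subsequence[of "\<lambda>n. norm (u n)"] by (auto simp: o_def)
  have "0 \<le> s" "s \<le> r"
    using LIMSEQ_le_const[OF lim] LIMSEQ_le_const2[OF lim] u by auto
  show ?thesis
  proof (cases "s = 0")
    case True
    have "0 < \<delta>' * r / 2" using assms by simp
    then obtain N where N: "\<And>n. n \<ge> N \<Longrightarrow> norm (u (g0 n)) < \<delta>' * r / 2"
      using order_tendstoD(2)[OF lim] True by (metis eventually_sequentially)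
    have "norm (u (g0 (n + N)) + 1 *\<^sub>R u (g0 (k + N))) \<le> \<delta>' * r" for n k
      using norm_triangle_ineq[of "u (g0 (n + N))" "u (g0 (k + N))"] N[of "n + N"] N[of "k + N"]
      by simp
    moreover have "strict_mono (\<lambda>n. g0 (n + N))"
      using g0 by (auto simp: strict_mono_def)
    ultimately show ?thesis by blast
  next
    case False
    with \<open>0 \<le> s\<close> have "0 < s" by simp
    \<comment> \<open>The bound \<open>s\<close> keeps the vectors nonzero; the other bound pays for
      replacing both \<open>v (g n)\<close> and \<open>v (g k)\<close> by multiples of unit
      vectors.\<close>
    define \<eta> where "\<eta> = min s ((\<delta>' - \<delta>) * s / 2)"
    have \<eta>_le: "2 * \<eta> \<le> (\<delta>' - \<delta>) * s"
      by (simp add: \<eta>_def min_def)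
    have "0 < \<eta>" using assms \<open>0 < s\<close> by (simp add: \<eta>_def)
    then obtain N where N: "\<And>n. n \<ge> N \<Longrightarrow> \<bar>norm (u (g0 n)) - s\<bar> < \<eta>"
      using LIMSEQ_D[OF lim] by (metis real_norm_def)
    define v where "v n = u (g0 (n + N))" for n
    have v: "\<bar>norm (v n) - s\<bar> < \<eta>" for n
      by (simp add: v_def N)
    have v0: "v n \<noteq> 0" for n
    proof
      assume "v n = 0"
      with v[of n] \<open>0 < s\<close> have "s < \<eta>" by simp
      then show False by (simp add: \<eta>_def)
    qed
    define y where "y n = v n /\<^sub>R norm (v n)" for n
    have y: "norm (y n) = 1" for n
      using v0 by (simp add: y_def)
    have vy: "norm (v n - s *\<^sub>R y n) < \<eta>" for n
    proof -
      have "v n - s *\<^sub>R y n = (norm (v n) - s) *\<^sub>R y n"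
        using v0 by (simp add: y_def algebra_simps)
      then show ?thesis using v[of n] y[of n] by simp
    qed
    \<comment> \<open>The colour is itself the sign to be used as a scalar; 0 means that the pair is
      separated for both signs.\<close>
    define f :: "(nat \<Rightarrow> nat) \<Rightarrow> real" where
      "f p = (if norm (y (p 0) + y (p 1)) < \<delta> then 1
              else if norm (y (p 0) - y (p 1)) < \<delta> then -1 else 0)" for p
    have "\<exists>(g :: nat \<Rightarrow> nat) c. strict_mono g \<and> (\<forall>p. strict_mono_on {..<2} p \<longrightarrow> f (g \<circ> p) = c)"
      by (rule Ramsey_increasing[of "{-1, 0, 1}"]) (auto simp: f_def)
    then obtain g :: "nat \<Rightarrow> nat" and c where g: "strict_mono g"
      and c: "\<And>p. strict_mono_on {..<2} p \<Longrightarrow> f (g \<circ> p) = c" by blast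
    have c': "f (\<lambda>i. g (if i = 0 then n else k)) = c" if "n < k" for n k
      using c[of "\<lambda>i. if i = 0 then n else k"] that
      by (auto simp: o_def strict_mono_on_def)
    have "c \<noteq> 0"
    proof
      assume "c = 0"
      then have le: "norm (y (g n) + y (g k)) \<ge> \<delta>" "norm (y (g n) - y (g k)) \<ge> \<delta>" if "n < k" for n k
        using c'[OF that] by (auto simp: f_def split: if_splits)
      have "symmetrically_separated \<delta> (y \<circ> g)"
        unfolding symmetrically_separated_def
        by (metis le comp_apply add.commute norm_minus_commute nat_neq_iff)
      moreover have "\<forall>n. (y \<circ> g) n \<in> sphere 0 1"
        using y by simp
      ultimately show False using nsep by blast
    qed
    then have c1: "c \<in> {-1, 1}"
      using c'[of 0 1] by (auto simp: f_def split: if_splits)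
    have yc: "norm (y (g n) + c *\<^sub>R y (g k)) \<le> \<delta>" if "n < k" for n k
      using c'[OF that] c1 by (auto simp: f_def split: if_splits)
    have "norm (v (g n) + c *\<^sub>R v (g k)) \<le> \<delta>' * r" if "n < k" for n k
    proof -
      have "v (g n) + c *\<^sub>R v (g k) = s *\<^sub>R (y (g n) + c *\<^sub>R y (g k))
          + ((v (g n) - s *\<^sub>R y (g n)) + c *\<^sub>R (v (g k) - s *\<^sub>R y (g k)))"
        by (simp add: algebra_simps)
      then have "norm (v (g n) + c *\<^sub>R v (g k)) \<le> s * norm (y (g n) + c *\<^sub>R y (g k))
          + (norm (v (g n) - s *\<^sub>R y (g n)) + norm (c *\<^sub>R (v (g k) - s *\<^sub>R y (g k))))"
        using \<open>0 < s\<close> by (metis (no_types) norm_scaleR norm_triangle_mono norm_triangle_ineq order_refl abs_of_pos)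
      also have "\<dots> \<le> s * \<delta> + (\<eta> + \<eta>)"
        using yc[OF that] vy[of "g n"] vy[of "g k"] c1 \<open>0 < s\<close>
        by (intro add_mono mult_left_mono) auto
      also have "\<dots> \<le> \<delta>' * s"
        using \<eta>_le by (simp add: algebra_simps)
      also have "\<dots> \<le> \<delta>' * r"
        using \<open>s \<le> r\<close> assms by (intro mult_left_mono) auto
      finally show ?thesis .
    qed
    moreover have "strict_mono (\<lambda>n. g0 (g n + N))"
      using g g0 by (auto simp: strict_mono_def)
    ultimately show ?thesis
      using c1 unfolding v_def by blast
  qed
qed

text \<open>Pair up the terms of a subsequence from \<open>unseparated_subsequence\<close> and apply
  the induction hypothesis to the pair sums: each round doubles the number of terms but multiplies
  the bound only by \<open>\<delta>'\<close>.\<close>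

lemma small_signed_sums:
  fixes u :: "nat \<Rightarrow> 'a::real_normed_vector"
  assumes nsep: "\<not> (\<exists>y :: nat \<Rightarrow> 'a. (\<forall>n. y n \<in> sphere 0 1) \<and> symmetrically_separated \<delta> y)"
    and "0 \<le> \<delta>" "\<delta> < \<delta>'" "0 < r" "\<And>n. norm (u n) \<le> r"
  shows "\<exists>F \<theta>. finite F \<and> card F = 2 ^ m \<and> \<theta> ` F \<subseteq> {-1, 1} \<and>
    norm (\<Sum>n\<in>F. \<theta> n *\<^sub>R u n) \<le> \<delta>' ^ m * r"
  using assms(4,5)
proof (induction m arbitrary: u r)
  case 0
  then show ?case
    by (intro exI[where x = "{0}"] exI[where x = "\<lambda>_. 1"]) simp
next
  case (Suc m)
  obtain g :: "nat \<Rightarrow> nat" and \<sigma> where g: "strict_mono g" and \<sigma>: "\<sigma> \<in> {-1, 1}"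
    and le: "\<And>n k. n < k \<Longrightarrow> norm (u (g n) + \<sigma> *\<^sub>R u (g k)) \<le> \<delta>' * r"
    using unseparated_subsequence[of \<delta> \<delta>' r u, OF nsep assms(2,3) Suc.prems] by blast
  define w where "w j = u (g (2 * j)) + \<sigma> *\<^sub>R u (g (2 * j + 1))" for j
  have "0 < \<delta>' * r" using assms Suc.prems by simp
  moreover have "norm (w j) \<le> \<delta>' * r" for j
    unfolding w_def by (rule le) simp
  ultimately have "\<exists>F \<theta>. finite F \<and> card F = 2 ^ m \<and> \<theta> ` F \<subseteq> {-1, 1} \<and>
      norm (\<Sum>n\<in>F. \<theta> n *\<^sub>R w n) \<le> \<delta>' ^ m * (\<delta>' * r)"
    by (rule Suc.IH[of "\<delta>' * r" w])
  then obtain F \<theta> where F: "finite F" "card F = 2 ^ m" and \<theta>: "\<theta> ` F \<subseteq> {-1, 1}"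
    and sum: "norm (\<Sum>n\<in>F. \<theta> n *\<^sub>R w n) \<le> \<delta>' ^ m * (\<delta>' * r)"
    by (elim exE conjE)
  define G where "G = (\<lambda>j. g (2 * j)) ` F"
  define H where "H = (\<lambda>j. g (2 * j + 1)) ` F"
  \<comment> \<open>\<open>inv g\<close> recovers the position in the subsequence. Even positions
    open a pair and inherit its sign; odd ones carry the extra factor
    \<open>\<sigma>\<close>.\<close>
  define \<tau> where "\<tau> i = (let l = inv g i in if even l then \<theta> (l div 2) else \<sigma> * \<theta> (l div 2))" for i
  have g_inj: "inj g" using g by (rule strict_mono_imp_inj_on)
  have \<tau>: "\<tau> (g (2 * j)) = \<theta> j" "\<tau> (g (2 * j + 1)) = \<sigma> * \<theta> j" for j
    using g_inj by (simp_all add: \<tau>_def)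
  have iG: "inj_on (\<lambda>j. g (2 * j)) F" and iH: "inj_on (\<lambda>j. g (2 * j + 1)) F"
    by (auto simp: inj_on_def inj_eq[OF g_inj])
  have disj: "G \<inter> H = {}"
    by (auto simp: G_def H_def inj_eq[OF g_inj]) presburger
  have "(\<Sum>n\<in>G \<union> H. \<tau> n *\<^sub>R u n) = (\<Sum>n\<in>G. \<tau> n *\<^sub>R u n) + (\<Sum>n\<in>H. \<tau> n *\<^sub>R u n)"
    using disj F by (intro sum.union_disjoint) (auto simp: G_def H_def)
  also have "\<dots> = (\<Sum>j\<in>F. \<theta> j *\<^sub>R u (g (2 * j))) + (\<Sum>j\<in>F. (\<sigma> * \<theta> j) *\<^sub>R u (g (2 * j + 1)))"
    unfolding G_def H_def sum.reindex[OF iG] sum.reindex[OF iH] o_def \<tau> ..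
  also have "\<dots> = (\<Sum>n\<in>F. \<theta> n *\<^sub>R w n)"
    by (simp add: w_def sum.distrib scaleR_add_right mult.commute)
  finally have "norm (\<Sum>n\<in>G \<union> H. \<tau> n *\<^sub>R u n) \<le> \<delta>' ^ Suc m * r"
    using sum by (simp add: mult_ac)
  moreover have "card (G \<union> H) = 2 ^ Suc m"
  proof -
    have "card G = 2 ^ m" "card H = 2 ^ m"
      using F iG iH by (simp_all add: G_def H_def card_image)
    then show ?thesis
      using F disj by (subst card_Un_disjoint) (auto simp: G_def H_def)
  qed
  moreover have "\<tau> ` (G \<union> H) \<subseteq> {-1, 1}"
  proof -
    have "\<theta> j = -1 \<or> \<theta> j = 1" if "j \<in> F" for j
      using \<theta> that by blast
    then show ?thesis
      using \<sigma> unfolding G_def H_def image_Un image_image \<tau> by force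
  qed
  moreover have "finite (G \<union> H)"
    using F by (simp add: G_def H_def)
  ultimately show ?case by blast
qed

subsection \<open>Separated sequences from the Riesz lemma\<close>

text \<open>If \<open>a\<close> has distance \<open>d > 0\<close> from the closed span, then
  \<open>coeff\<close> controls the coefficient of \<open>a\<close> by the norm. Along a convergent
  sequence these coefficients are therefore Cauchy, and the remaining parts converge inside the
  closed span of \<open>S\<close>.\<close>

lemma closed_span_insert:
  fixes S :: "'a::real_normed_vector set"
  assumes "closed (span S)"
  shows "closed (span (insert a S))"
proof (cases "a \<in> span S")
  case True
  then show ?thesis using assms by (simp add: span_redundant)
next
  case False
  define d where "d = infdist a (span S)"
  have ne: "span S \<noteq> {}"
    using span_zero by blast
  have "0 < d"
    unfolding d_def using infdist_pos_not_in_closed[OF assms ne False] by simp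
  have coeff: "\<bar>c\<bar> * d \<le> norm (c *\<^sub>R a + s)" if s: "s \<in> span S" for c s
  proof (cases "c = 0")
    case False
    have "(- 1 / c) *\<^sub>R s \<in> span S"
      using s by (rule span_scale)
    then have "d \<le> dist a ((- 1 / c) *\<^sub>R s)"
      unfolding d_def by (rule infdist_le)
    then have "\<bar>c\<bar> * d \<le> \<bar>c\<bar> * norm (a - (- 1 / c) *\<^sub>R s)"
      by (simp add: dist_norm mult_left_mono)
    also have "\<dots> = norm (c *\<^sub>R (a - (- 1 / c) *\<^sub>R s))"
      by simp
    also have "c *\<^sub>R (a - (- 1 / c) *\<^sub>R s) = c *\<^sub>R a + s"
      using False by (simp add: algebra_simps)
    finally show ?thesis .
  qed simp
  show ?thesis
    unfolding closed_sequential_limits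
  proof (intro allI impI, elim conjE)
    fix v l
    assume v: "\<forall>n. v n \<in> span (insert a S)" and lim: "v \<longlonglongrightarrow> l"
    from v have "\<forall>n. \<exists>k. v n - k *\<^sub>R a \<in> span S"
      by (simp add: span_insert)
    then obtain c where c: "\<And>n. v n - c n *\<^sub>R a \<in> span S"
      by metis
    have "Cauchy c"
    proof (rule metric_CauchyI)
      fix e :: real assume "0 < e"
      then obtain N where N: "\<And>m n. m \<ge> N \<Longrightarrow> n \<ge> N \<Longrightarrow> dist (v m) (v n) < e * d"
        using metric_CauchyD[OF LIMSEQ_imp_Cauchy[OF lim], of "e * d"] \<open>0 < d\<close> by auto
      have "dist (c m) (c n) < e" if "m \<ge> N" "n \<ge> N" for m n
      proof -
        let ?s = "(v m - c m *\<^sub>R a) - (v n - c n *\<^sub>R a)"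
        have "\<bar>c m - c n\<bar> * d \<le> norm ((c m - c n) *\<^sub>R a + ?s)"
          by (intro coeff span_diff c)
        also have "(c m - c n) *\<^sub>R a + ?s = v m - v n"
          by (simp add: algebra_simps)
        also have "norm (v m - v n) < e * d"
          using N[OF that] by (simp add: dist_norm)
        finally show ?thesis
          using \<open>0 < d\<close> by (simp add: dist_real_def)
      qed
      then show "\<exists>N. \<forall>m\<ge>N. \<forall>n\<ge>N. dist (c m) (c n) < e" by blast
    qed
    then obtain c0 where "c \<longlonglongrightarrow> c0"
      using Cauchy_convergent convergentD by blast
    then have "(\<lambda>n. v n - c n *\<^sub>R a) \<longlonglongrightarrow> l - c0 *\<^sub>R a"
      using lim by (intro tendsto_intros)
    then have "l - c0 *\<^sub>R a \<in> span S"
      by (rule closed_sequentially[OF assms, rotated]) (rule c)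
    then show "l \<in> span (insert a S)"
      by (auto simp: span_insert)
  qed
qed

lemma closed_span_finite:
  fixes S :: "'a::real_normed_vector set"
  assumes "finite S"
  shows "closed (span S)"
  using assms by (induction S) (auto intro: closed_span_insert)

text \<open>Approximate a point outside the span to within twice its distance \<open>d\<close> and
  normalise the error: its distance to the span is at least \<open>d / r\<close>, which exceeds
  1/2.\<close>

lemma Riesz_lemma:
  fixes S :: "'a::real_normed_vector set"
  assumes "closed (span S)" "span S \<noteq> UNIV"
  shows "\<exists>v. norm v = 1 \<and> (\<forall>s\<in>span S. 1 / 2 \<le> norm (v - s))"
proof -
  obtain w where w: "w \<notin> span S" using assms by blast
  define d where "d = infdist w (span S)"
  have ne: "span S \<noteq> {}" using span_zero by blast
  have "0 < d"
    unfolding d_def using infdist_pos_not_in_closed[OF assms(1) ne w] by simp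
  then have "infdist w (span S) < 2 * d" by (simp add: d_def)
  then obtain s0 where s0: "s0 \<in> span S" "dist w s0 < 2 * d"
    using cInf_lessD[of "dist w ` span S" "2 * d"] ne by (auto simp: infdist_notempty)
  define r where "r = norm (w - s0)"
  have r: "0 < r" "r < 2 * d"
    using w s0 by (auto simp: r_def dist_norm)
  have "1 / 2 \<le> norm ((w - s0) /\<^sub>R r - s)" if s: "s \<in> span S" for s
  proof -
    have "s0 + r *\<^sub>R s \<in> span S"
      using s s0 by (intro span_add span_scale)
    then have "d \<le> dist w (s0 + r *\<^sub>R s)"
      unfolding d_def by (rule infdist_le)
    also have "\<dots> = norm (r *\<^sub>R ((w - s0) /\<^sub>R r - s))"
      using r by (simp add: dist_norm algebra_simps)
    also have "\<dots> = r * norm ((w - s0) /\<^sub>R r - s)"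
      using r by simp
    finally have "r * (1 / 2) \<le> r * norm ((w - s0) /\<^sub>R r - s)"
      using r by linarith
    then show ?thesis
      using r by (simp add: mult_le_cancel_left_pos)
  qed
  moreover have "norm ((w - s0) /\<^sub>R r) = 1"
    using r by (simp add: r_def)
  ultimately show ?thesis by blast
qed

text \<open>Each new term comes from the Riesz lemma applied to the span of its predecessors, which
  is closed and proper.\<close>

lemma half_separated_sequence:
  assumes inf: "\<And>S :: 'a::real_normed_vector set. finite S \<Longrightarrow> span S \<noteq> UNIV"
  shows "\<exists>x :: nat \<Rightarrow> 'a. (\<forall>n. norm (x n) = 1) \<and> (\<forall>n k. n \<noteq> k \<longrightarrow> 1 / 2 \<le> norm (x n - x k))"
proof -
  have "\<exists>x :: nat \<Rightarrow> 'a. \<forall>n. norm (x n) = 1 \<and> (\<forall>k<n. 1 / 2 \<le> norm (x n - x k))"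
  proof (rule dependent_wellorder_choice)
    fix x :: "nat \<Rightarrow> 'a" and n
    let ?S = "x ` {..<n}"
    have fin: "finite ?S" by simp
    obtain v where "norm v = 1" "\<And>s. s \<in> span ?S \<Longrightarrow> 1 / 2 \<le> norm (v - s)"
      using Riesz_lemma[OF closed_span_finite[OF fin] inf[OF fin]] by blast
    then show "\<exists>v. norm v = 1 \<and> (\<forall>k<n. 1 / 2 \<le> norm (v - x k))"
      by (meson image_eqI lessThan_iff span_base)
  qed simp
  then obtain x :: "nat \<Rightarrow> 'a" where "\<And>n. norm (x n) = 1"
    and "\<And>n k. k < n \<Longrightarrow> 1 / 2 \<le> norm (x n - x k)" by blast
  then show ?thesis
    by (metis nat_neq_iff norm_minus_commute)
qed

text \<open>Lets the cotype argument work with real scalars only: \<open>smul\<close> extends real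
  multiplication, so a finite set spanning over the reals would also span over
  \<open>'k\<close>.\<close>

lemma real_span_neq_UNIV:
  fixes smul :: "'k::real_or_complex \<Rightarrow> 'a::banach \<Rightarrow> 'a" and S :: "'a set"
  assumes "banach_over smul" "infinite_dimensional smul" "finite S"
  shows "span S \<noteq> UNIV"
proof
  interpret K: banach_over smul by fact
  assume "span S = UNIV"
  have "v \<in> K.span S" if "v \<in> span S" for v
    using that
  proof (induction rule: span_induct_alt)
    case base
    show ?case by (rule K.span_zero)
  next
    case (step c a v)
    then show ?case
      by (metis K.span_add K.span_base K.span_scale K.smul_of_real)
  qed
  with \<open>span S = UNIV\<close> have "K.span S = UNIV" by blast
  with assms show False
    unfolding infinite_dimensional_def by blast
qed

subsection \<open>Lower estimates\<close>

lemma separated_of_lower_estimate: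
  fixes smul :: "'k::real_or_complex \<Rightarrow> 'a::banach \<Rightarrow> 'a" and x :: "nat \<Rightarrow> 'a"
  assumes "banach_over smul" "0 < q" and norm_x: "normalised x" and low: "lower_estimate smul q x"
    and t: "0 < t" "t < 1"
  shows "\<exists>y :: nat \<Rightarrow> 'a. (\<forall>n. y n \<in> sphere 0 1) \<and>
           symmetrically_separated (2 powr (1 / q) * t) y"
proof -
  interpret K: banach_over smul by fact
  define V where "V A a = (\<Sum>k\<in>A. smul (a k) (x k))" for A and a :: "nat \<Rightarrow> 'k"
  define S where "S A a = (\<Sum>k\<in>A. norm (a k) powr q)" for A :: "nat set" and a :: "nat \<Rightarrow> 'k"
  define lower where "lower n \<kappa> \<longleftrightarrow> (\<forall>A a. finite A \<and> A \<subseteq> {n..} \<longrightarrow>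
    \<kappa> * S A a powr (1 / q) \<le> norm (V A a))" for n :: nat and \<kappa> :: real
  have S_nonneg: "0 \<le> S A a" for A a
    by (simp add: S_def sum_nonneg)
  obtain c where "0 < c" and c: "\<And>N a. c * S {..<N} a powr (1 / q) \<le> norm (V {..<N} a)"
    using low unfolding lower_estimate_def S_def V_def by blast
  have base: "lower 0 c"
    unfolding lower_def
  proof (intro allI impI, elim conjE)
    fix A :: "nat set" and a :: "nat \<Rightarrow> 'k"
    assume "finite A"
    then obtain N where N: "A \<subseteq> {..<N}"
      using finite_nat_bounded by blast
    \<comment> \<open>Padding with zeros turns an arbitrary finite support into an initial segment;
      \<open>S\<close> is unchanged because \<open>0 powr q = 0\<close>.\<close>
    let ?b = "\<lambda>k. if k \<in> A then a k else 0"
    have "S {..<N} ?b = S A a"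
      unfolding S_def using N by (intro sum.mono_neutral_cong_right) auto
    moreover have "V {..<N} ?b = V A a"
      unfolding V_def using N by (intro sum.mono_neutral_cong_right) auto
    ultimately show "c * S A a powr (1 / q) \<le> norm (V A a)"
      using c[of N ?b] by simp
  qed
  have lower_le_1: "\<kappa> \<le> 1" if "lower n \<kappa>" for n \<kappa>
    using that[unfolded lower_def, rule_format, of "{n}" "\<lambda>_. 1"] norm_x
    by (simp add: S_def V_def normalised_def)
  have "\<exists>n \<kappa>. 0 < \<kappa> \<and> lower n \<kappa> \<and> (\<forall>m\<ge>n. \<exists>A a. finite A \<and> A \<subseteq> {m..} \<and>
      norm (V A a) = 1 \<and> t / \<kappa> \<le> S A a powr (1 / q))"
  proof (rule ccontr)
    assume neg: "\<not> ?thesis"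
    \<comment> \<open>If \<open>\<kappa>\<close> is not almost optimal, some tail has only norm-one
      vectors with coefficient norm below \<open>t / \<kappa>\<close>; by homogeneity the constant
      there improves by the factor \<open>1 / t\<close>.\<close>
    have step: "\<exists>m. lower m (\<kappa> / t)" if "0 < \<kappa>" and low_n: "lower n \<kappa>" for n \<kappa>
    proof -
      obtain m where "n \<le> m" and m: "\<And>A a. finite A \<Longrightarrow> A \<subseteq> {m..} \<Longrightarrow> norm (V A a) = 1 \<Longrightarrow>
          S A a powr (1 / q) < t / \<kappa>"
        using neg \<open>0 < \<kappa>\<close> low_n by (meson not_le)
      have "\<kappa> / t * S A a powr (1 / q) \<le> norm (V A a)" if A: "finite A" "A \<subseteq> {m..}" for A a
      proof (cases "V A a = 0")
        case True
        have "\<kappa> * S A a powr (1 / q) \<le> norm (V A a)"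
          using low_n A \<open>n \<le> m\<close> unfolding lower_def by (meson atLeast_subset_iff order_trans)
        then have "S A a powr (1 / q) = 0"
          using True \<open>0 < \<kappa>\<close> by (simp add: mult_le_0_iff)
        then show ?thesis using True by simp
      next
        case False
        define v where "v = norm (V A a)"
        have "0 < v" using False by (simp add: v_def)
        let ?b = "\<lambda>k. of_real (1 / v) * a k"
        have "V A ?b = smul (of_real (1 / v)) (V A a)"
          unfolding V_def by (simp add: K.scale_sum_right)
        then have "norm (V A ?b) = 1"
          using \<open>0 < v\<close> by (simp add: K.norm_smul norm_divide v_def)
        then have "S A ?b powr (1 / q) < t / \<kappa>"
          using m A by blast
        moreover have "S A ?b = (1 / v) powr q * S A a"
          using \<open>0 < v\<close> by (simp add: S_def norm_mult norm_divide powr_mult sum_distrib_left powr_divide)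
        then have "S A ?b powr (1 / q) = 1 / v * S A a powr (1 / q)"
          using \<open>0 < v\<close> \<open>0 < q\<close> S_nonneg by (simp add: powr_mult powr_powr)
        ultimately have "1 / v * S A a powr (1 / q) < t / \<kappa>"
          by simp
        then show ?thesis
          using \<open>0 < v\<close> \<open>0 < \<kappa>\<close> t by (simp add: v_def[symmetric] field_simps)
      qed
      then show ?thesis
        unfolding lower_def by blast
    qed
    \<comment> \<open>Repeated improvement would push the constant beyond 1, which a single
      normalised vector forbids.\<close>
    have "\<exists>n. lower n (c / t ^ j)" for j
    proof (induction j)
      case 0
      show ?case using base by auto
    next
      case (Suc j)
      then obtain n where "lower n (c / t ^ j)" by blast
      moreover have "0 < c / t ^ j" using \<open>0 < c\<close> t by simp
      ultimately have "\<exists>m. lower m (c / t ^ j / t)" by (intro step)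
      then show ?case by (simp add: mult.commute)
    qed
    then have "c / t ^ j \<le> 1" for j
      using lower_le_1 by blast
    moreover obtain j where "t ^ j < c"
      using real_arch_pow_inv \<open>0 < c\<close> t by blast
    ultimately show False
      using t by (metis divide_le_eq_1_pos not_le zero_less_power)
  qed
  then obtain n \<kappa> where "0 < \<kappa>" and low_n: "lower n \<kappa>"
    and "\<forall>m. n \<le> m \<longrightarrow> (\<exists>A a. finite A \<and> A \<subseteq> {m..} \<and> norm (V A a) = 1 \<and> t / \<kappa> \<le> S A a powr (1 / q))"
    by blast
  then obtain A a where A: "\<And>m. n \<le> m \<Longrightarrow> finite (A m)" "\<And>m. n \<le> m \<Longrightarrow> A m \<subseteq> {m..}"
    and V1: "\<And>m. n \<le> m \<Longrightarrow> norm (V (A m) (a m)) = 1"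
    and S_ge: "\<And>m. n \<le> m \<Longrightarrow> t / \<kappa> \<le> S (A m) (a m) powr (1 / q)"
    by metis
  have sep: "2 powr (1 / q) * t \<le> norm (V (A m) (a m) + smul \<sigma> (V (A l) (a l)))"
    if ml: "n \<le> m" "n \<le> l" and disj: "A m \<inter> A l = {}" and \<sigma>: "norm \<sigma> = 1" for m l \<sigma>
  proof -
    have S_ge': "(t / \<kappa>) powr q \<le> S (A m) (a m)" if "n \<le> m" for m
    proof -
      have "(t / \<kappa>) powr q \<le> (S (A m) (a m) powr (1 / q)) powr q"
        using S_ge[OF that] t \<open>0 < \<kappa>\<close> \<open>0 < q\<close> by (intro powr_mono2) auto
      also have "\<dots> = S (A m) (a m)"
        using \<open>0 < q\<close> S_nonneg by (simp add: powr_powr)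
      finally show ?thesis .
    qed
    \<comment> \<open>Coefficients of the signed sum on the union of the two supports. The splitting
      below is stated for a generic \<open>h\<close> so that it serves both the real sum
      \<open>S\<close> and the vector sum \<open>V\<close>.\<close>
    let ?b = "\<lambda>k. if k \<in> A m then a m k else \<sigma> * a l k"
    have eq: "(\<Sum>k\<in>A m \<union> A l. h k (?b k))
        = (\<Sum>k\<in>A m. h k (a m k)) + (\<Sum>k\<in>A l. h k (\<sigma> * a l k))"
      for h :: "nat \<Rightarrow> 'k \<Rightarrow> 'z::comm_monoid_add"
    proof -
      have "(\<Sum>k\<in>A l. h k (?b k)) = (\<Sum>k\<in>A l. h k (\<sigma> * a l k))"
        using disj by (intro sum.cong) auto
      then show ?thesis
        using A ml disj by (simp add: sum.union_disjoint)
    qed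
    have "2 powr (1 / q) * t = \<kappa> * (2 * (t / \<kappa>) powr q) powr (1 / q)"
      using t \<open>0 < \<kappa>\<close> \<open>0 < q\<close> by (simp add: powr_mult powr_powr)
    also have "\<dots> \<le> \<kappa> * (S (A m) (a m) + S (A l) (a l)) powr (1 / q)"
      using S_ge'[OF ml(1)] S_ge'[OF ml(2)] \<open>0 < \<kappa>\<close> \<open>0 < q\<close>
      by (intro mult_left_mono powr_mono2) auto
    also have "S (A m) (a m) + S (A l) (a l) = S (A m \<union> A l) ?b"
      unfolding S_def eq[of "\<lambda>k z. norm z powr q"] using \<sigma> by (simp add: norm_mult)
    also have "\<kappa> * S (A m \<union> A l) ?b powr (1 / q) \<le> norm (V (A m \<union> A l) ?b)"
    proof -
      have "finite (A m \<union> A l)" "A m \<union> A l \<subseteq> {n..}"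
        using A[OF ml(1)] A[OF ml(2)] ml by auto
      then show ?thesis
        using low_n unfolding lower_def by blast
    qed
    also have "V (A m \<union> A l) ?b = V (A m) (a m) + smul \<sigma> (V (A l) (a l))"
      unfolding V_def eq[of "\<lambda>k z. smul z (x k)"] by (simp add: K.scale_sum_right)
    finally show ?thesis .
  qed
  \<comment> \<open>Each new start lies beyond the whole support of the previous vector, which makes
    the supports disjoint. Inserting \<open>m\<close> keeps the maximum meaningful and
    \<open>s\<close> strictly increasing.\<close>
  define s where "s j = ((\<lambda>m. Suc (Max (insert m (A m)))) ^^ j) n" for j
  have s_Suc: "s (Suc j) = Suc (Max (insert (s j) (A (s j))))" for j
    by (simp add: s_def)
  have s_ge: "n \<le> s j" and A_less: "k \<in> insert (s j) (A (s j)) \<Longrightarrow> k < s (Suc j)" for j k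
  proof -
    show ge: "n \<le> s j" for j
    proof (induction j)
      case 0
      show ?case by (simp add: s_def)
    next
      case (Suc j)
      then have "s j \<le> Max (insert (s j) (A (s j)))"
        using A(1) by (intro Max_ge) auto
      with Suc show ?case by (simp add: s_Suc)
    qed
    assume "k \<in> insert (s j) (A (s j))"
    then have "k \<le> Max (insert (s j) (A (s j)))"
      using A(1)[OF ge] by (intro Max_ge) auto
    then show "k < s (Suc j)"
      by (simp add: s_Suc)
  qed
  have "strict_mono s"
    using A_less by (auto simp: strict_mono_Suc_iff)
  have disj: "A (s j) \<inter> A (s l) = {}" if "j < l" for j l
  proof -
    have "s (Suc j) \<le> s l"
      using \<open>strict_mono s\<close> that by (simp add: strict_mono_less_eq Suc_leI)
    then show ?thesis
      using A_less[of _ j] A(2)[OF s_ge, of l] by fastforce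
  qed
  then have disj': "A (s j) \<inter> A (s l) = {}" if "j \<noteq> l" for j l
    using that by (metis inf_commute nat_neq_iff)
  define y where "y j = V (A (s j)) (a (s j))" for j
  have "symmetrically_separated (2 powr (1 / q) * t) y"
    unfolding symmetrically_separated_def y_def
    using sep[OF s_ge s_ge disj', of _ _ 1] sep[OF s_ge s_ge disj', of _ _ "- 1"] by simp
  moreover have "y j \<in> sphere 0 1" for j
    by (simp add: y_def V1 s_ge)
  ultimately show ?thesis by blast
qed

subsection \<open>Cotype\<close>

lemma rademacher_mean_square_le:
  assumes "\<And>s. s \<in> {..<N} \<rightarrow>\<^sub>E {-1, 1 :: real} \<Longrightarrow> norm (\<Sum>n<N. s n *\<^sub>R x n) \<le> B"
  shows "rademacher_mean_square N x \<le> B\<^sup>2"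
proof -
  have "(\<Sum>s \<in> {..<N} \<rightarrow>\<^sub>E {-1, 1 :: real}. (norm (\<Sum>n<N. s n *\<^sub>R x n))\<^sup>2)
      \<le> of_nat (card ({..<N} \<rightarrow>\<^sub>E {-1, 1 :: real})) * B\<^sup>2"
    using assms by (intro sum_bounded_above power_mono) auto
  also have "card ({..<N} \<rightarrow>\<^sub>E {-1, 1 :: real}) = 2 ^ N"
    by (simp add: card_PiE numeral_2_eq_2)
  finally show ?thesis
    by (simp add: rademacher_mean_square_def divide_le_eq mult.commute)
qed

text \<open>Cotype forces mean signed sums of \<open>2 ^ m\<close> vectors of norm at least 1/2 to
  grow like \<open>2 powr (m / q)\<close>, whereas without a separated sequence some such sums are
  all bounded by a multiple of \<open>\<delta>' ^ m\<close>. The bound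
  \<open>1 \<le> \<delta>\<close> ensures \<open>\<delta>' ^ m \<ge> 1\<close>, so additive
  constants can be absorbed.\<close>

lemma separated_of_cotype:
  assumes inf: "\<And>S :: 'a::real_normed_vector set. finite S \<Longrightarrow> span S \<noteq> UNIV"
    and cotype: "has_cotype TYPE('a) q" and "0 < q" and \<delta>: "1 \<le> \<delta>" "\<delta> < 2 powr (1 / q)"
  shows "\<exists>y :: nat \<Rightarrow> 'a. (\<forall>n. y n \<in> sphere 0 1) \<and> symmetrically_separated \<delta> y"
proof (rule ccontr)
  assume nsep: "\<not> (\<exists>y :: nat \<Rightarrow> 'a. (\<forall>n. y n \<in> sphere 0 1) \<and> symmetrically_separated \<delta> y)"
  obtain C where "0 < C" and C: "\<And>N (x :: nat \<Rightarrow> 'a).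
      (\<Sum>n<N. norm (x n) powr q) powr (1 / q) \<le> C * sqrt (rademacher_mean_square N x)"
    using cotype unfolding has_cotype_def by blast
  obtain x :: "nat \<Rightarrow> 'a" where x: "\<And>n. norm (x n) = 1"
    and x_sep: "\<And>n k. n \<noteq> k \<Longrightarrow> 1 / 2 \<le> norm (x n - x k)"
    using half_separated_sequence[OF inf] by blast
  obtain \<delta>' where \<delta>': "\<delta> < \<delta>'" "\<delta>' < 2 powr (1 / q)"
    using dense[OF \<delta>(2)] by blast
  have "1 < \<delta>'" using \<delta> \<delta>' by simp
  have "1 < 2 powr (1 / q) / \<delta>'"
    using \<delta>' \<open>1 < \<delta>'\<close> by simp
  \<comment> \<open>The factor 10 combines the 5 in \<open>B\<close> with the 1/2 bounding the norms
    of the differences from below.\<close>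
  then obtain m where m: "10 * C < (2 powr (1 / q) / \<delta>') ^ m"
    using real_arch_pow by blast
  have "\<exists>z :: nat \<Rightarrow> 'a. (\<forall>n. \<exists>i j. i \<noteq> j \<and> z n = x i - x j) \<and>
    (\<forall>F A \<theta>. finite F \<and> card F = 2 ^ m \<and> A \<subseteq> F \<and> \<theta> ` F \<subseteq> {-1, 1} \<longrightarrow>
       norm (\<Sum>n\<in>A. \<theta> n *\<^sub>R z n) \<le> norm (\<Sum>n\<in>F. \<theta> n *\<^sub>R z n) + 1 / 2)"
    by (rule almost_unconditional_differences) (simp_all add: x)
  then obtain z :: "nat \<Rightarrow> 'a" where z: "\<forall>n. \<exists>i j. i \<noteq> j \<and> z n = x i - x j"
    and z_unc: "\<forall>F A \<theta>. finite F \<and> card F = 2 ^ m \<and> A \<subseteq> F \<and> \<theta> ` F \<subseteq> {-1, 1} \<longrightarrow>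
       norm (\<Sum>n\<in>A. \<theta> n *\<^sub>R z n) \<le> norm (\<Sum>n\<in>F. \<theta> n *\<^sub>R z n) + 1 / 2"
    by (elim exE conjE)
  have z_le: "norm (z n) \<le> 2" and z_ge: "1 / 2 \<le> norm (z n)" for n
  proof -
    obtain i j where ij: "i \<noteq> j" "z n = x i - x j" using z by blast
    then show "norm (z n) \<le> 2"
      using norm_triangle_ineq4[of "x i" "x j"] x by simp
    show "1 / 2 \<le> norm (z n)"
      using x_sep ij by simp
  qed
  have "\<exists>F \<theta>. finite F \<and> card F = 2 ^ m \<and> \<theta> ` F \<subseteq> {-1, 1} \<and>
      norm (\<Sum>n\<in>F. \<theta> n *\<^sub>R z n) \<le> \<delta>' ^ m * 2"
    using \<delta> \<delta>' z_le by (intro small_signed_sums[OF nsep]) auto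
  then obtain F \<theta> where F: "finite F" "card F = 2 ^ m" and \<theta>: "\<theta> ` F \<subseteq> {-1, 1}"
    and F_le: "norm (\<Sum>n\<in>F. \<theta> n *\<^sub>R z n) \<le> \<delta>' ^ m * 2"
    by (elim exE conjE)
  have sub_le: "norm (\<Sum>n\<in>A. \<theta> n *\<^sub>R z n) \<le> \<delta>' ^ m * 2 + 1 / 2" if "A \<subseteq> F" for A
    using z_unc[rule_format, of F A \<theta>] F \<theta> F_le that by linarith
  \<comment> \<open>Arbitrary signs split \<open>F\<close> into the part agreeing with
    \<open>\<theta>\<close> and the part opposed to it. Two partial sums, each at most
    \<open>2 * \<delta>' ^ m + 1 / 2\<close>, give \<open>4 * \<delta>' ^ m + 1\<close>, hence the
    5.\<close>
  define B where "B = 5 * \<delta>' ^ m"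
  have "1 \<le> \<delta>' ^ m"
    using \<open>1 < \<delta>'\<close> by (simp add: one_le_power)
  then have "0 \<le> B" by (simp add: B_def)
  have all_signs: "norm (\<Sum>n\<in>F. s n *\<^sub>R z n) \<le> B" if s: "s ` F \<subseteq> {-1, 1}" for s
  proof -
    define A where "A = {n \<in> F. s n = \<theta> n}"
    have A: "A \<subseteq> F" by (auto simp: A_def)
    have eq: "s n = - \<theta> n" if "n \<in> F - A" for n
      using that s \<theta> unfolding A_def by fastforce
    have "(\<Sum>n\<in>F. s n *\<^sub>R z n) = (\<Sum>n\<in>F - A. s n *\<^sub>R z n) + (\<Sum>n\<in>A. s n *\<^sub>R z n)"
      by (rule sum.subset_diff[OF A F(1)])
    also have "(\<Sum>n\<in>F - A. s n *\<^sub>R z n) = - (\<Sum>n\<in>F - A. \<theta> n *\<^sub>R z n)"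
      by (simp add: eq flip: sum_negf)
    also have "(\<Sum>n\<in>A. s n *\<^sub>R z n) = (\<Sum>n\<in>A. \<theta> n *\<^sub>R z n)"
      by (simp add: A_def)
    finally have "norm (\<Sum>n\<in>F. s n *\<^sub>R z n)
        \<le> norm (\<Sum>n\<in>F - A. \<theta> n *\<^sub>R z n) + norm (\<Sum>n\<in>A. \<theta> n *\<^sub>R z n)"
      using norm_triangle_ineq by (metis norm_minus_cancel)
    also have "\<dots> \<le> (\<delta>' ^ m * 2 + 1 / 2) + (\<delta>' ^ m * 2 + 1 / 2)"
      using A by (intro add_mono sub_le) auto
    also have "\<dots> \<le> B"
      using \<open>1 \<le> \<delta>' ^ m\<close> by (simp add: B_def)
    finally show ?thesis .
  qed
  obtain h where h: "bij_betw h {..<2 ^ m :: nat} F"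
    using ex_bij_betw_nat_finite[OF F(1)] F(2) by (auto simp: atLeast0LessThan)
  have "rademacher_mean_square (2 ^ m) (z \<circ> h) \<le> B\<^sup>2"
  proof (rule rademacher_mean_square_le)
    fix s :: "nat \<Rightarrow> real"
    assume s: "s \<in> {..<2 ^ m} \<rightarrow>\<^sub>E {-1, 1 :: real}"
    let ?g = "inv_into {..<2 ^ m :: nat} h"
    have g: "?g (h n) = n" if "n < 2 ^ m" for n
      using h that by (simp add: bij_betw_inv_into_left)
    have "(s \<circ> ?g) ` F \<subseteq> {-1, 1}"
    proof
      fix v assume "v \<in> (s \<circ> ?g) ` F"
      then obtain n where "n \<in> F" "v = s (?g n)" by auto
      moreover have "?g n \<in> {..<2 ^ m}" if "n \<in> F"
        using bij_betwE[OF bij_betw_inv_into[OF h]] that by blast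
      ultimately show "v \<in> {-1, 1}" using s by blast
    qed
    then have "norm (\<Sum>n\<in>F. (s \<circ> ?g) n *\<^sub>R z n) \<le> B"
      by (rule all_signs)
    also have "(\<Sum>n\<in>F. (s \<circ> ?g) n *\<^sub>R z n) = (\<Sum>n<2 ^ m. (s \<circ> ?g) (h n) *\<^sub>R z (h n))"
      using h by (rule sum.reindex_bij_betw[symmetric])
    also have "\<dots> = (\<Sum>n<2 ^ m. s n *\<^sub>R (z \<circ> h) n)"
      by (simp add: g)
    finally show "norm (\<Sum>n<2 ^ m. s n *\<^sub>R (z \<circ> h) n) \<le> B" .
  qed
  then have rad: "sqrt (rademacher_mean_square (2 ^ m) (z \<circ> h)) \<le> B"
    using \<open>0 \<le> B\<close> by (rule real_le_lsqrt[rotated])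
  \<comment> \<open>The left side is the \<open>q\<close>-norm of \<open>2 ^ m\<close> entries equal
    to 1/2, a lower bound for the cotype sum.\<close>
  have "(2 powr (1 / q)) ^ m / 2 = (2 ^ m * (1 / 2) powr q) powr (1 / q)"
  proof -
    have "(2 powr (1 / q)) ^ m = (2 ^ m) powr (1 / q)"
      by (simp add: powr_powr powr_realpow[symmetric] mult.commute)
    moreover have "((1 / 2 :: real) powr q) powr (1 / q) = 1 / 2"
      unfolding powr_powr using \<open>0 < q\<close> by simp
    ultimately show ?thesis by (simp add: powr_mult)
  qed
  also have "\<dots> \<le> (\<Sum>n<2 ^ m. norm ((z \<circ> h) n) powr q) powr (1 / q)"
  proof (rule powr_mono2)
    have "(\<Sum>n<2 ^ m :: nat. (1 / 2) powr q) \<le> (\<Sum>n<2 ^ m. norm ((z \<circ> h) n) powr q)"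
      using z_ge \<open>0 < q\<close> by (intro sum_mono powr_mono2) auto
    then show "2 ^ m * (1 / 2) powr q \<le> (\<Sum>n<2 ^ m. norm ((z \<circ> h) n) powr q)"
      by simp
  qed (use \<open>0 < q\<close> in auto)
  also have "\<dots> \<le> C * sqrt (rademacher_mean_square (2 ^ m) (z \<circ> h))"
    by (rule C)
  also have "\<dots> \<le> C * B"
    using rad \<open>0 < C\<close> by simp
  finally have "(2 powr (1 / q) / \<delta>') ^ m \<le> 10 * C"
    using \<open>1 < \<delta>'\<close> by (simp add: B_def power_divide field_simps)
  with m show False by simp
qed

section \<open>Choice of the separation constants in the two cases\<close>

theorem theoremC:
  fixes smul :: "'k::real_or_complex \<Rightarrow> 'a::banach \<Rightarrow> 'a"
    and q \<epsilon> :: real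
  assumes "banach_over smul"
    and "infinite_dimensional smul"
    and "(0 < q \<and> (\<exists>x. normalised x \<and> basic_sequence smul x \<and> lower_estimate smul q x)) \<or>
         (2 \<le> q \<and> has_cotype TYPE('a) q)"
    and "\<epsilon> > 0"
  shows "\<exists>y :: nat \<Rightarrow> 'a. (\<forall>n. y n \<in> sphere 0 1) \<and>
           symmetrically_separated (2 powr (1 / q) - \<epsilon>) y"
proof -
  have weaken: "symmetrically_separated (2 powr (1 / q) - \<epsilon>) y"
    if "symmetrically_separated \<delta> y" "2 powr (1 / q) - \<epsilon> \<le> \<delta>" for \<delta> and y :: "nat \<Rightarrow> 'a"
    using that(1) by (auto simp: symmetrically_separated_def intro: order_trans[OF that(2)])
  show ?thesis
    using assms(3)
  proof (elim disjE conjE exE)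
    fix x assume "0 < q" "normalised x" "lower_estimate smul q x"
    \<comment> \<open>The second entry loses at most \<open>\<epsilon>\<close> from
      \<open>2 powr (1 / q)\<close>; the first keeps \<open>t\<close> positive when
      \<open>\<epsilon>\<close> is large.\<close>
    define t where "t = max (1 / 2) (1 - \<epsilon> / 2 powr (1 / q))"
    have "0 < t" "t < 1"
      using \<open>\<epsilon> > 0\<close> by (auto simp: t_def)
    have "2 powr (1 / q) - \<epsilon> = 2 powr (1 / q) * (1 - \<epsilon> / 2 powr (1 / q))"
      by (simp add: right_diff_distrib)
    also have "\<dots> \<le> 2 powr (1 / q) * t"
      by (intro mult_left_mono) (auto simp: t_def)
    finally show ?thesis
      using separated_of_lower_estimate[OF assms(1) \<open>0 < q\<close> \<open>normalised x\<close> \<open>lower_estimate smul q x\<close>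
          \<open>0 < t\<close> \<open>t < 1\<close>] by (auto dest: weaken)
  next
    assume q: "2 \<le> q" "has_cotype TYPE('a) q"
    \<comment> \<open>Raising the constant to at least 1 meets the requirement of
      \<open>separated_of_cotype\<close>; it stays below \<open>2 powr (1 / q)\<close>, which
      exceeds 1.\<close>
    define \<delta> where "\<delta> = max 1 (2 powr (1 / q) - \<epsilon>)"
    have "1 < 2 powr (1 / q)"
      using q by simp
    then have "\<delta> < 2 powr (1 / q)"
      using \<open>\<epsilon> > 0\<close> by (simp add: \<delta>_def)
    then have "\<exists>y :: nat \<Rightarrow> 'a. (\<forall>n. y n \<in> sphere 0 1) \<and> symmetrically_separated \<delta> y"
      using q real_span_neq_UNIV[OF assms(1,2)]
      by (intro separated_of_cotype[where q = q]) (auto simp: \<delta>_def)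
    moreover have "2 powr (1 / q) - \<epsilon> \<le> \<delta>"
      by (simp add: \<delta>_def)
    ultimately show ?thesis
      by (auto dest: weaken)
  qed
qed

end
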